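(* Let $n\ge 1$ and let $A,B\in \mathrm{SGL}_n(\mathbb{F}_2)$ be such that $B-A=\sum_{i=1}^r \mathbf{x}_i\mathbf{x}_i^{\top}$ for some linearly independent column vectors $\mathbf{x}_1,\ldots,\mathbf{x}_r\in\mathbb{F}_2^n$ ($r\ge 1$). (i) If $\mathbf{x}_i^{\top}A^{-1}\mathbf{x}_i=1$ for all $i$, then $d(A,B)=r+2$ if $\mathbf{x}_i^{\top}A^{-1}\mathbf{x}_j=1$ for all $i,j$, and $d(A,B)=r+1$ otherwise. (ii) If the $r\times r$ matrix $[\mathbf{x}_i^{\top}A^{-1}\mathbf{x}_j]_{i,j=1}^r$ belongs to $\mathcal{R}_1^{\mathrm{Tr}_0}$, then $d(A,B)=r+2$. (iii) Otherwise (i.e. if neither the hypothesis of (i) nor that of (ii) holds), $d(A,B)=r$.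
   Context: $\mathbb{F}_2$ is the binary field. $\mathrm{SGL}_n(\mathbb{F}_2)$ is the set of invertible symmetric $n\times n$ matrices over $\mathbb{F}_2$. $\Gamma_n$ is the graph with vertex set $\mathrm{SGL}_n(\mathbb{F}_2)$ in which $A,B$ are adjacent iff $\mathrm{rank}(A-B)=1$; $d(A,B)$ denotes the graph distance in $\Gamma_n$. For a size $m$, $\mathcal{R}_1^{\mathrm{Tr}_0}$ denotes the set of symmetric $m\times m$ matrices over $\mathbb{F}_2$ of rank one and trace zero. *)

theory Defs
  imports "HOL-Analysis.Analysis" "HOL-Library.Z2" "HOL-Library.Extended_Nat"
begin

text \<open>The binary field F_2 is the type bit from HOL-Library.Z2.
  Matrices over F_2 of size n x n are elements of bit^'n^'n, the size n being CARD('n).\<close>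

definition SGL :: "(bit^'n^'n) set" where
  "SGL = {A. transpose A = A \<and> invertible A}"

definition gamma_adj :: "bit^'n^'n \<Rightarrow> bit^'n^'n \<Rightarrow> bool" where
  "gamma_adj A B \<longleftrightarrow> A \<in> SGL \<and> B \<in> SGL \<and> rank (A - B) = 1"

text \<open>Graph distance in Gamma_n (infinity if no path exists).\<close>
definition gamma_dist :: "bit^'n^'n \<Rightarrow> bit^'n^'n \<Rightarrow> enat" where
  "gamma_dist A B = Inf {enat k | k. \<exists>p :: nat \<Rightarrow> bit^'n^'n.
       p 0 = A \<and> p k = B \<and> (\<forall>i\<le>k. p i \<in> SGL) \<and> (\<forall>i<k. gamma_adj (p i) (p (Suc i)))}"

definition outer :: "bit^'n \<Rightarrow> bit^'n^'n" where
  "outer x = (\<chi> i j. x $ i * x $ j)"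

definition bform :: "bit^'n^'n \<Rightarrow> bit^'n \<Rightarrow> bit^'n \<Rightarrow> bit" where
  "bform M x y = (\<Sum>k\<in>UNIV. x $ k * (M *v y) $ k)"

definition R1Tr0 :: "(bit^'m^'m) set" where
  "R1Tr0 = {G. transpose G = G \<and> rank G = 1 \<and> trace G = 0}"

end

theory Submission
  imports Defs
begin

text \<open>
  Write f(u, v) for the form u^T A^{-1} v and G for the Gram matrix f(x_i, x_j). By the
  Sherman-Morrison formula, A + p p^T is invertible iff f(p, p) = 0, and the step to it replaces f
  by f(u, v) + f(p, u) f(p, v). So B is reached in r steps iff the vectors x_i, up to an orthogonal
  change of the family (which does not affect the sum of the x_i x_i^T), can be consumed one after
  the other, each having a zero diagonal entry in the current Gram matrix.

  Lower bounds: a walk writes B - A as a sum of k terms y_j y_j^T, and duality against the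
  independent x_i gives k >= r. If G has diagonal 1 and k = r, then f(y_1, y_1) = 1, so the first
  step is singular. If G has rank one and k <= r + 1, then all y_j lie in the span of the x_i,
  where f(u, v) = f(u, u) f(v, v); the first y_j with f(y_j, y_j) = 1 would make its step singular,
  so f vanishes on the span, a contradiction.

  Upper bounds: as long as G is zero, or has a zero diagonal entry and rank greater than one, some
  vector can be consumed so that the smaller Gram matrix is again of this kind. This needs no
  independence, so it also settles the exceptional cases: append the vector 0 if G has diagonal 1,
  and append an isotropic vector y twice if G has rank one.
\<close>

subsection \<open>Vectors and matrices over the binary field\<close>

text \<open>These rules of Z2 rewrite field operations to bit operations and so block ring reasoning.\<close>

declare add_bit_eq_xor [simp del] mult_bit_eq_and [simp del]

lemma bit_add_self [simp]: "(a::bit) + a = 0"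
  by (cases a) auto

lemma bit_add_left_self [simp]: "(a::bit) + (a + b) = b"
  by (simp add: add.assoc[symmetric])

lemma bit_mult_self [simp]: "(a::bit) * a = a"
  by (cases a) auto

lemma vec_bit_add_self [simp]: "(u::bit^'n) + u = 0"
  by (simp add: vec_eq_iff)

lemma vec_bit_add_left_self [simp]: "(u::bit^'n) + (u + v) = v"
  by (simp add: vec_eq_iff)

lemma vec_bit_add_eq_0_iff: "(u::bit^'n) + v = 0 \<longleftrightarrow> u = v"
  by (metis add.right_neutral vec_bit_add_left_self)

lemma mat_bit_add_self [simp]: "(U::bit^'n^'m) + U = 0"
  by (simp add: vec_eq_iff)

lemma mat_bit_diff: "(U::bit^'n^'m) - V = U + V"
  by (simp add: vec_eq_iff)

lemma mat_bit_add_left_self [simp]: "(U::bit^'n^'m) + (U + V) = V"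
  by (simp add: vec_eq_iff)

subsection \<open>Bilinear forms\<close>

lemma bform_scalar_product: "bform M u v = scalar_product u (M *v v)"
  by (simp add: bform_def scalar_product_def)

lemma bform_add_left: "bform M (u + u') v = bform M u v + bform M u' v"
  by (simp add: bform_def distrib_right sum.distrib)

lemma bform_add_right: "bform M u (v + v') = bform M u v + bform M u v'"
  by (simp add: bform_def matrix_vector_right_distrib distrib_left sum.distrib)

lemma bform_zero_left [simp]: "bform M 0 v = 0"
  by (simp add: bform_def)

lemma bform_zero_right [simp]: "bform M u 0 = 0"
  by (simp add: bform_def)

lemma bform_scale_left: "bform M (c *s u) v = c * bform M u v"
  by (simp add: bform_def sum_distrib_left mult.assoc)

lemma bform_scale_right: "bform M u (c *s v) = c * bform M u v"
  by (simp add: bform_def sum_distrib_left vector_scalar_commute mult.left_commute)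

lemma bform_sum_right: "bform M u (\<Sum>i\<in>I. v i) = (\<Sum>i\<in>I. bform M u (v i))"
  by (induction I rule: infinite_finite_induct) (auto simp: bform_add_right)

lemma bform_add_matrix: "bform (M + N) u v = bform M u v + bform N u v"
  by (simp add: bform_def matrix_vector_mult_add_rdistrib distrib_left sum.distrib)

lemma bform_commute:
  assumes "transpose M = M"
  shows "bform M u v = bform M v u"
proof -
  have "M $ k $ l = M $ l $ k" for k l
    using assms by (metis transpose_def vec_lambda_beta)
  then show ?thesis
    unfolding bform_def matrix_vector_mult_def
    by (simp add: sum_distrib_left)
       (subst sum.swap, simp add: mult.commute mult.left_commute)
qed

lemma outer_mult_vec: "outer p *v w = scalar_product p w *s p"
  by (simp add: vec_eq_iff outer_def matrix_vector_mult_def scalar_product_def sum_distrib_left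
      mult.commute mult.left_commute)

lemma transpose_outer [simp]: "transpose (outer p) = outer p"
  by (simp add: vec_eq_iff outer_def transpose_def mult.commute)

lemma outer_zero [simp]: "outer 0 = 0"
  by (simp add: vec_eq_iff outer_def)

lemma sum_matrix_mult_vec: "(\<Sum>i\<in>I. M i) *v (w::'a::comm_ring_1^'n) = (\<Sum>i\<in>I. M i *v w)"
  by (induction I rule: infinite_finite_induct) (auto simp: matrix_vector_mult_add_rdistrib)

lemma sum_outer_mult_vec:
  "(\<Sum>i\<in>I. outer (x i)) *v w = (\<Sum>i\<in>I. scalar_product (x i) w *s x i)"
  by (simp add: sum_matrix_mult_vec outer_mult_vec)

lemma transpose_add: "transpose (M + N) = transpose M + transpose N"
  by (simp add: vec_eq_iff transpose_def)

subsection \<open>Invertible symmetric matrices\<close>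

lemma matrix_inv_mult:
  assumes "invertible A"
  shows "A ** matrix_inv A = mat 1" "matrix_inv A ** A = mat 1"
  using someI_ex[OF assms[unfolded invertible_def]] unfolding matrix_inv_def by auto

lemma SGL_inv_apply:
  assumes "A \<in> SGL"
  shows "A *v (matrix_inv A *v v) = v" "matrix_inv A *v (A *v v) = v"
  using assms matrix_inv_mult[of A] by (auto simp: SGL_def matrix_vector_mul_assoc)

lemma matrix_inv_eqI:
  fixes A :: "'a::field^'n^'n"
  assumes "A ** C = mat 1"
  shows "matrix_inv A = C"
proof -
  have "invertible A" using assms matrix_left_right_inverse unfolding invertible_def by blast
  then have "matrix_inv A ** (A ** C) = C"
    by (simp add: matrix_mul_assoc matrix_inv_mult)
  then show ?thesis using assms by simp
qed

lemma transpose_matrix_inv: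
  assumes "A \<in> SGL"
  shows "transpose (matrix_inv A) = matrix_inv A"
proof -
  have "A ** transpose (matrix_inv A) = mat 1"
    using assms matrix_inv_mult(2)[of A] matrix_transpose_mul[of "matrix_inv A" A]
    by (simp add: SGL_def transpose_mat)
  then show ?thesis using matrix_inv_eqI by metis
qed

lemma SGL_kernel_trivial:
  assumes "A \<in> SGL" "A *v w = 0"
  shows "w = 0"
  using SGL_inv_apply(2)[OF assms(1), of w] assms(2) by simp

text \<open>For w = A^{-1} v, the end matrix maps w to v + sum f(x_i, v) x_i = v + v = 0. This is
  the form in which invertibility of the end matrix enters the later arguments.\<close>

lemma SGL_sum_outer_kernel:
  assumes "A \<in> SGL" "A + (\<Sum>i\<in>I. outer (x i)) \<in> SGL"
    and "(\<Sum>i\<in>I. bform (matrix_inv A) (x i) v *s x i) = v"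
  shows "v = 0"
proof -
  have "(A + (\<Sum>i\<in>I. outer (x i))) *v (matrix_inv A *v v) = v + v"
    using assms(3) unfolding bform_scalar_product
    by (simp add: matrix_vector_mult_add_rdistrib SGL_inv_apply[OF assms(1)] sum_outer_mult_vec)
  then have "matrix_inv A *v v = 0"
    using SGL_kernel_trivial[OF assms(2)] by simp
  then show ?thesis using SGL_inv_apply(1)[OF assms(1), of v] by simp
qed

text \<open>Sherman-Morrison with denominator 1 + f(p, p) = 1: the inverse is A^{-1} + q q^T with q
  = A^{-1} p.\<close>

lemma SGL_add_outer:
  assumes A: "A \<in> SGL" and p: "bform (matrix_inv A) p p = 0"
  shows "A + outer p \<in> SGL"
    and "bform (matrix_inv (A + outer p)) u v =
      bform (matrix_inv A) u v + bform (matrix_inv A) p u * bform (matrix_inv A) p v"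
proof -
  let ?M = "matrix_inv A"
  let ?q = "?M *v p"
  have pv: "scalar_product p (?M *v v) = scalar_product ?q v" for v
    using bform_commute[OF transpose_matrix_inv[OF A], of p v]
    by (simp add: bform_scalar_product scalar_product_def mult.commute)
  have "(A + outer p) *v ((?M + outer ?q) *v v) = v" for v
  proof -
    have "(A + outer p) *v ((?M + outer ?q) *v v)
      = v + scalar_product ?q v *s p + scalar_product p (?M *v v) *s p
        + scalar_product ?q v *s (scalar_product p ?q *s p)"
      by (simp add: matrix_vector_mult_add_rdistrib matrix_vector_right_distrib outer_mult_vec
          SGL_inv_apply[OF A] vector_scalar_commute)
    then show ?thesis using p by (simp add: pv bform_scalar_product add.assoc)
  qed
  then have inv: "(A + outer p) ** (?M + outer ?q) = mat 1"
    unfolding matrix_eq by (simp add: matrix_vector_mul_assoc[symmetric])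
  have "invertible (A + outer p)"
    using inv matrix_left_right_inverse unfolding invertible_def by blast
  then show "A + outer p \<in> SGL"
    using A by (simp add: SGL_def transpose_add)
  show "bform (matrix_inv (A + outer p)) u v = bform ?M u v + bform ?M p u * bform ?M p v"
  proof -
    have "bform (outer ?q) u v = scalar_product ?q v * bform ?M u p"
      by (simp add: bform_scalar_product outer_mult_vec scalar_product_def sum_distrib_left mult.left_commute)
    moreover have "scalar_product ?q v = bform ?M p v"
      by (simp add: bform_scalar_product pv)
    ultimately show ?thesis
      using matrix_inv_eqI[OF inv] bform_commute[OF transpose_matrix_inv[OF A], of p u]
      by (simp add: bform_add_matrix mult.commute)
  qed
qed

subsection \<open>Symmetric matrices of rank one\<close>

lemma column_outer: "column j (outer y) = (y $ j) *s y"
  by (simp add: vec_eq_iff column_def outer_def mult.commute)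

text \<open>If every column is a multiple c_j y, symmetry makes c proportional to y, and 1 is the
  only nonzero scalar.\<close>

lemma symmetric_rank_one_iff:
  fixes M :: "bit^'n^'n"
  assumes "transpose M = M"
  shows "rank M = 1 \<longleftrightarrow> (\<exists>y. y \<noteq> 0 \<and> M = outer y)"
proof
  assume "rank M = 1"
  then have d: "vec.dim (columns M) = 1"
    using assms by (metis row_rank_def_gen rows_transpose)
  obtain b where b: "b \<subseteq> columns M" "vec.independent b" "columns M \<subseteq> vec.span b" "card b = 1"
    using vec.basis_exists[of "columns M"] d by metis
  then obtain y where y: "b = {y}" by (meson card_1_singletonE)
  have "y \<noteq> 0" using b(2) y by auto
  have "\<exists>c. column j M = c *s y" for j
    using b(3) y by (auto simp: columns_def vec.span_singleton)
  then obtain c where c: "column j M = c j *s y" for j by metis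
  have M: "M $ i $ j = c j * y $ i" for i j
    using c[of j] by (simp add: vec_eq_iff column_def)
  obtain k where k: "y $ k = 1" using \<open>y \<noteq> 0\<close> by (auto simp: vec_eq_iff)
  have S: "M $ i $ j = M $ j $ i" for i j
    using assms by (metis transpose_def vec_lambda_beta)
  have cj: "c j = c k * y $ j" for j
    using S[of k j] by (simp add: M k)
  \<comment> \<open>\<open>y\<close> was chosen among the columns of \<open>M\<close>, so they
    cannot all vanish.\<close>
  have "c k = 1"
  proof (rule ccontr)
    assume "c k \<noteq> 1"
    then have "column j M = 0" for j using c[of j] cj[of j] by simp
    then have "y = 0" using b(1) y by (auto simp: columns_def)
    then show False using \<open>y \<noteq> 0\<close> by simp
  qed
  then have "M $ i $ j = y $ i * y $ j" for i j
    using M[of i j] cj[of j] by (simp only: mult_1_left mult.commute)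
  then have "M = outer y"
    by (simp add: vec_eq_iff outer_def)
  then show "\<exists>y. y \<noteq> 0 \<and> M = outer y" using \<open>y \<noteq> 0\<close> by blast
next
  assume "\<exists>y. y \<noteq> 0 \<and> M = outer y"
  then obtain y where y: "y \<noteq> 0" "M = outer y" by blast
  then obtain k where k: "y $ k = 1" by (auto simp: vec_eq_iff)
  have "vec.dim (columns M) = 1"
  proof (rule vec.dim_unique)
    have "column k M = y" using y k by (simp add: column_outer)
    then show "{y} \<subseteq> columns M" by (auto simp: columns_def)
    show "columns M \<subseteq> vec.span {y}" using y by (auto simp: columns_def column_outer vec.span_singleton)
  qed (use y in auto)
  then show "rank M = 1" using assms by (metis row_rank_def_gen rows_transpose)
qed

subsection \<open>Consuming one vector of a family\<close>

text \<open>An orthogonal transformation of four coordinates. Together with permutations it is all that is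
  needed of the orthogonal group over the binary field.\<close>

definition switch4 :: "('i \<Rightarrow> bit^'n) \<Rightarrow> 'i \<Rightarrow> 'i \<Rightarrow> 'i \<Rightarrow> 'i \<Rightarrow> 'i \<Rightarrow> bit^'n" where
  "switch4 x a b c d = x(a := x b + x c + x d, b := x a + x c + x d,
                         c := x a + x b + x d, d := x a + x b + x c)"

lemma switch4_simps:
  assumes "distinct [a, b, c, d]"
  shows "switch4 x a b c d a = x b + x c + x d"
    and "switch4 x a b c d b = x a + x c + x d"
    and "switch4 x a b c d c = x a + x b + x d"
    and "switch4 x a b c d d = x a + x b + x c"
    and "k \<notin> {a, b, c, d} \<Longrightarrow> switch4 x a b c d k = x k"
  using assms by (auto simp: switch4_def)

text \<open>The coefficient matrix is J + I with J all ones of size four. It is symmetric and J J =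
  4 J = 0, so it is orthogonal.\<close>

lemma outer_switch4:
  "outer (b + c + d) + (outer (a + c + d) + (outer (a + b + d) + outer (a + b + c)))
    = outer a + (outer b + (outer c + outer d))"
proof -
  have "(b + c + d) * (b' + c' + d') + ((a + c + d) * (a' + c' + d') +
      ((a + b + d) * (a' + b' + d') + (a + b + c) * (a' + b' + c')))
    = a * a' + (b * b' + (c * c' + d * d'))" for a b c d a' b' c' d' :: bit
    by (cases a; cases b; cases c; cases d) (auto simp: ac_simps)
  then show ?thesis
    by (simp add: vec_eq_iff outer_def)
qed

lemma sum_outer_switch4:
  fixes x :: "'a \<Rightarrow> bit^'n"
  assumes "finite I" "{a, b, c, d} \<subseteq> I" "distinct [a, b, c, d]"
  shows "(\<Sum>i\<in>I. outer (switch4 x a b c d i)) = (\<Sum>i\<in>I. outer (x i))"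
proof -
  have split: "(\<Sum>i\<in>I. F i) = (F a + (F b + (F c + F d))) + (\<Sum>i\<in>I - {a, b, c, d}. F i)"
    for F :: "'a \<Rightarrow> bit^'n^'n"
    using sum.subset_diff[OF assms(2,1), of F] assms(3) by (simp add: add.commute)
  show ?thesis
    unfolding split[of "\<lambda>i. outer (switch4 x a b c d i)"] split[of "\<lambda>i. outer (x i)"]
    using switch4_simps[OF assms(3), where x = x] outer_switch4[of "x b" "x c" "x d" "x a"]
    by (auto intro!: arg_cong2[where f = plus] sum.cong)
qed

text \<open>The first disjunct covers the empty family; the second excludes Gram matrices of rank at most
  one, which are exactly those with g i j = g i i * g j j.\<close>

definition reducible :: "('i \<Rightarrow> 'i \<Rightarrow> bit) \<Rightarrow> 'i set \<Rightarrow> bool" where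
  "reducible g I \<longleftrightarrow> (\<forall>i\<in>I. \<forall>j\<in>I. g i j = 0) \<or>
     (\<exists>i\<in>I. g i i = 0) \<and> (\<exists>i\<in>I. \<exists>j\<in>I. g i j \<noteq> g i i * g j j)"

text \<open>The Gram matrix of x after the step by p.\<close>

abbreviation schur :: "(bit^'n \<Rightarrow> bit^'n \<Rightarrow> bit) \<Rightarrow> bit^'n \<Rightarrow> ('i \<Rightarrow> bit^'n) \<Rightarrow> 'i \<Rightarrow> 'i \<Rightarrow> bit" where
  "schur f p x i j \<equiv> f (x i) (x j) + f p (x i) * f p (x j)"

lemma reducibleI:
  "\<lbrakk>k \<in> I; g k k = 0; i \<in> I; j \<in> I; g i j \<noteq> g i i * g j j\<rbrakk> \<Longrightarrow> reducible g I"
  unfolding reducible_def by blast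

text \<open>\<open>nonsing\<close> expresses invertibility of the end matrix through
  \<open>f\<close> and \<open>x\<close> alone. It depends only on the sum of the x_i x_i^T, so
  switched families inherit it.\<close>

locale gram_family =
  fixes f :: "bit^'n \<Rightarrow> bit^'n \<Rightarrow> bit" and x :: "'i \<Rightarrow> bit^'n" and I :: "'i set"
  assumes add_left: "f (u + u') v = f u v + f u' v"
    and sym: "f u v = f v u"
    and scale_left: "f (c *s u) v = c * f u v"
    and fin: "finite I"
    and nonsing: "(\<Sum>i\<in>I. f (x i) v *s x i) = v \<Longrightarrow> v = 0"
begin

lemma add_right: "f u (v + v') = f u v + f u v'"
  by (metis add_left sym)

lemma scale_right: "f u (c *s v) = c * f u v"
  by (metis scale_left sym)

lemma zero_left [simp]: "f 0 v = 0"
  using add_left[of 0 0 v] by simp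

lemma zero_right [simp]: "f v 0 = 0"
  using zero_left sym by metis

text \<open>The family may first be replaced by one with the same sum of outer products, which keeps
  the end matrix of the walk.\<close>

definition removable :: bool where
  "removable \<longleftrightarrow> (\<exists>x' p. p \<in> I \<and> (\<Sum>i\<in>I. outer (x' i)) = (\<Sum>i\<in>I. outer (x i)) \<and>
     f (x' p) (x' p) = 0 \<and> reducible (schur f (x' p) x') (I - {p}))"

lemma removableI:
  assumes "p \<in> I" "f (x p) (x p) = 0" "reducible (schur f (x p) x) (I - {p})"
  shows removable
  using assms unfolding removable_def by blast

lemma removable_switch4I:
  assumes "{a, b, c, d} \<subseteq> I" "distinct [a, b, c, d]"
    and "p \<in> I" "f (switch4 x a b c d p) (switch4 x a b c d p) = 0"
    and "reducible (schur f (switch4 x a b c d p) (switch4 x a b c d)) (I - {p})"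
  shows removable
  using assms sum_outer_switch4[OF fin assms(1,2)] unfolding removable_def by blast

text \<open>
  If consuming p leaves a Gram matrix of rank one, then f (x i) (x j) = h i * h j + g i * g j away
  from p. An index q with h q = g q can be consumed instead; if there is none, some switch
  involving p, an index u with (h, g) = (1, 0) and two indices with (h, g) = (0, 1) helps.
\<close>

lemma removable_rank_one_case:
  assumes p: "p \<in> I" "f (x p) (x p) = 0"
    and sq: "\<And>i j. i \<in> I - {p} \<Longrightarrow> j \<in> I - {p} \<Longrightarrow>
      schur f (x p) x i j = schur f (x p) x i i * schur f (x p) x j j"
    and t: "t \<in> I - {p}" "schur f (x p) x t t = 1"
    and nsq: "i0 \<in> I" "j0 \<in> I" "f (x i0) (x j0) \<noteq> f (x i0) (x i0) * f (x j0) (x j0)"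
  shows removable
proof -
  define h where "h i = f (x p) (x i)" for i
  define g where "g i = schur f (x p) x i i" for i
  have hp: "f (x i) (x p) = h i" for i by (simp add: h_def sym)
  have ph: "f (x p) (x i) = h i" for i by (simp add: h_def)
  have hpp: "h p = 0" using p(2) by (simp add: h_def)
  have fg: "f (x i) (x j) = h i * h j + g i * g j" if "i \<in> I - {p}" "j \<in> I - {p}" for i j
  proof -
    have "f (x i) (x j) + h i * h j = g i * g j"
      using sq[OF that] by (simp only: g_def h_def)
    then show ?thesis by (metis add.commute bit_add_left_self)
  qed
  have other: "\<exists>t'\<in>I - {p, t}. g t' = 1" if t: "t \<in> I - {p}" "g t = 1" for t
  proof (rule ccontr)
    assume "\<not> ?thesis"
    then have z: "g i = 0" if "i \<in> I - {p, t}" for i using that by auto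
    \<comment> \<open>Away from \<open>p\<close>, \<open>f (x i) v = g i * g t\<close>, which
      vanishes unless \<open>i = t\<close>, while \<open>f (x p) v = h t\<close>. Hence the sum in
      \<open>nonsing\<close> reproduces \<open>v\<close>.\<close>
    define v where "v = x t + h t *s x p"
    have v: "f (x i) v = f (x i) (x t) + h t * h i" for i
      by (simp add: v_def add_right scale_right hp)
    have rest: "f (x i) v = 0" if "i \<in> I - {p, t}" for i
      using that t z[OF that] by (simp add: v fg mult.commute)
    have tv: "f (x t) v = 1"
      using t by (simp add: v fg)
    have "p \<noteq> t" using t by auto
    have pv: "f (x p) v = h t"
      by (simp add: v ph hpp)
    have "(\<Sum>i\<in>I. f (x i) v *s x i) = (\<Sum>i\<in>{p, t}. f (x i) v *s x i)"
      using p t rest by (intro sum.mono_neutral_right) (auto simp: fin)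
    also have "\<dots> = h t *s x p + x t"
      using \<open>p \<noteq> t\<close> by (simp add: tv pv)
    finally have "v = 0" using nonsing by (simp add: v_def add.commute)
    then show False using tv by simp
  qed
  have ii: "f (x i) (x i) = h i + g i" if "i \<in> I - {p}" for i
    using fg[OF that that] by simp
  show ?thesis
  proof (cases "\<exists>q\<in>I - {p}. h q = 0 \<and> g q = 0")
    case True
    then obtain q where q: "q \<in> I - {p}" "h q = 0" "g q = 0" by blast
    \<comment> \<open>\<open>x q\<close> is orthogonal to the whole family, so its step changes no
      Gram entry, and \<open>p\<close>, \<open>i0\<close>, \<open>j0\<close> remain
      witnesses.\<close>
    have q0: "f (x q) (x j) = 0" if "j \<in> I" for j
      using that q fg[OF q(1), of j] hp[of q] by (cases "j = p") auto
    then have q0': "f (x j) (x q) = 0" if "j \<in> I" for j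
      using that sym by metis
    have "i0 \<noteq> q" "j0 \<noteq> q" using q0 q0' nsq by auto
    then have "reducible (schur f (x q) x) (I - {q})"
      using nsq p q q0 by (intro reducibleI[of p _ _ i0 j0]) auto
    then show ?thesis using q q0 by (intro removableI) auto
  next
    case nz: False
    show ?thesis
    proof (cases "\<exists>q\<in>I - {p}. h q = 1 \<and> g q = 1")
      case True
      then obtain q where q: "q \<in> I - {p}" "h q = 1" "g q = 1" by blast
      obtain t' where t': "t' \<in> I - {p, q}" "g t' = 1" using other[OF q(1,3)] by blast
      \<comment> \<open>After the step by \<open>x q\<close>, the diagonal entry at
        \<open>t'\<close> is (h t' + 1) + (h t' + 1) = 0, while the entry at (p, t') is h t' + (h t'
        + 1) = 1.\<close>
      have "reducible (schur f (x q) x) (I - {q})"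
        using t' q p hp[of q] ph[of t'] fg[of q t'] ii[of t']
        by (intro reducibleI[of t' _ _ p t']) (cases "h t'"; auto)+
      moreover have "f (x q) (x q) = 0" using ii q by auto
      ultimately show ?thesis using q by (intro removableI) auto
    next
      case no: False
      have excl: "h i = 1 + g i" if "i \<in> I - {p}" for i
      proof -
        have "\<not> (h i = 0 \<and> g i = 0)" "\<not> (h i = 1 \<and> g i = 1)" using nz no that by blast+
        then show ?thesis by (cases "h i"; cases "g i") auto
      qed
      obtain t1 where t1: "t1 \<in> I - {p}" "g t1 = 1" using t by (auto simp: g_def)
      obtain t2 where t2: "t2 \<in> I - {p, t1}" "g t2 = 1" using other[OF t1] by blast
      \<comment> \<open>If h vanished, the Gram matrix would be g g^T, against
        \<open>nsq\<close>.\<close>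
      have "\<exists>u\<in>I - {p}. h u = 1"
      proof (rule ccontr)
        assume "\<not> ?thesis"
        then have h0: "h i = 0" if "i \<in> I" for i using that hpp by (cases "i = p") auto
        have "f (x i) (x j) = f (x i) (x i) * f (x j) (x j)" if "i \<in> I" "j \<in> I" for i j
          using that h0 fg[of i j] ii[of i] ii[of j] hp[of i] ph[of j] p(2)
          by (cases "i = p"; cases "j = p") auto
        then show False using nsq by blast
      qed
      then obtain u where u: "u \<in> I - {p}" "h u = 1" by blast
      have hg: "g u = 0" "h t1 = 0" "h t2 = 0"
        using excl[OF u(1)] excl[OF t1(1)] excl[of t2] t1 t2 u by (cases "g u"; auto)+
      have d: "distinct [p, u, t1, t2]" using t1 t2 u hg by auto
      note sw = switch4_simps[OF d, where x = x]
      have vals: "f (x p) (x p) = 0" "f (x u) (x u) = 1" "f (x t1) (x t1) = 1"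
        "f (x t2) (x t2) = 1" "f (x p) (x u) = 1" "f (x u) (x p) = 1" "f (x p) (x t1) = 0"
        "f (x t1) (x p) = 0" "f (x p) (x t2) = 0" "f (x t2) (x p) = 0"
        "f (x u) (x t1) = 0" "f (x t1) (x u) = 0" "f (x u) (x t2) = 0" "f (x t2) (x u) = 0"
        "f (x t1) (x t2) = 1" "f (x t2) (x t1) = 1"
        using fg[of u u] fg[of t1 t1] fg[of t2 t2] fg[of u t1] fg[of t1 u] fg[of u t2] fg[of t2 u]
          fg[of t1 t2] fg[of t2 t1] hp[of u] hp[of t1] hp[of t2] ph[of u] ph[of t1] ph[of t2]
          hg u t1 t2 p(2) by auto
      show ?thesis
      \<comment> \<open>The switched vectors at \<open>t2\<close> and \<open>t1\<close> are
        isotropic and orthogonal to each other, so \<open>t1\<close> keeps a zero diagonal entry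
        after the step by \<open>t2\<close>. The entry at (u, t1) stays 1.\<close>
      proof (rule removable_switch4I[OF _ d, of t2])
        show "{p, u, t1, t2} \<subseteq> I" "t2 \<in> I" using p u t1 t2 by auto
        show "f (switch4 x p u t1 t2 t2) (switch4 x p u t1 t2 t2) = 0"
          by (simp add: sw add_left add_right vals)
        show "reducible (schur f (switch4 x p u t1 t2 t2) (switch4 x p u t1 t2)) (I - {t2})"
          using d u t1 t2
          by (intro reducibleI[of t1 _ _ u t1]) (auto simp: sw add_left add_right vals)
      qed
    qed
  qed
qed

text \<open>The Gram matrix left by the step at \<open>p\<close> is not \<open>reducible\<close>, so
  it is nonzero of rank one or has diagonal 1. The former is excluded by
  \<open>removable_rank_one_case\<close>; the latter is the claim.\<close>

lemma not_removable_zero: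
  assumes nr: "\<not> removable"
    and p: "p \<in> I" "f (x p) (x p) = 0" and i: "i \<in> I - {p}"
    and nsq: "i0 \<in> I" "j0 \<in> I" "f (x i0) (x j0) \<noteq> f (x i0) (x i0) * f (x j0) (x j0)"
  shows "f (x p) (x i) = 1 + f (x i) (x i)"
proof -
  let ?g = "schur f (x p) x"
  have nred: "\<not> reducible ?g (I - {p})" using nr removableI[OF p] by blast
  show ?thesis
  proof (cases "\<forall>i\<in>I - {p}. \<forall>j\<in>I - {p}. ?g i j = ?g i i * ?g j j")
    case True
    have "?g t t = 0" if "t \<in> I - {p}" for t
    proof (rule ccontr)
      assume "?g t t \<noteq> 0"
      then have "?g t t = 1" by (simp only: bit_not_zero_iff)
      then show False using removable_rank_one_case[OF p _ that _ nsq] True nr by blast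
    qed
    then have "?g i j = 0" if "i \<in> I - {p}" "j \<in> I - {p}" for i j
      using True that by (metis (no_types, lifting) mult_zero_left)
    then show ?thesis using nred unfolding reducible_def by blast
  next
    case False
    then have "?g i i \<noteq> 0" using nred i unfolding reducible_def by blast
    then show ?thesis
      by (cases "f (x p) (x i)"; cases "f (x i) (x i)") auto
  qed
qed

text \<open>Otherwise \<open>not_removable_zero\<close> at \<open>p\<close> and at \<open>q\<close>
  shows that x p and x q pair equally with every other x i, and that f(x p, x q) = 1. Then v = x p +
  x q is reproduced by the sum in \<open>nonsing\<close>, yet it is not zero.\<close>

lemma removable_two_zeros:
  assumes p: "p \<in> I" "f (x p) (x p) = 0" and q: "q \<in> I" "f (x q) (x q) = 0" and "p \<noteq> q"
    and nsq: "i0 \<in> I" "j0 \<in> I" "f (x i0) (x j0) \<noteq> f (x i0) (x i0) * f (x j0) (x j0)"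
  shows removable
proof (rule ccontr)
  assume nr: "\<not> removable"
  note alpha = not_removable_zero[OF nr _ _ _ nsq]
  define v where "v = x p + x q"
  have pq: "f (x p) (x q) = 1" "f (x q) (x p) = 1"
    using alpha[OF p, of q] alpha[OF q, of p] p q \<open>p \<noteq> q\<close> by auto
  have pv: "f (x p) v = 1" "f (x q) v = 1" using p q pq by (simp_all add: v_def add_right)
  have rest: "f (x i) v = 0" if "i \<in> I - {p, q}" for i
    using that alpha[OF p, of i] alpha[OF q, of i] sym[of "x i" "x p"] sym[of "x i" "x q"]
    by (simp add: v_def add_right)
  have "(\<Sum>i\<in>I. f (x i) v *s x i) = (\<Sum>i\<in>{p, q}. f (x i) v *s x i)"
    using p q rest by (intro sum.mono_neutral_right) (auto simp: fin)
  also have "\<dots> = v" using \<open>p \<noteq> q\<close> pv by (simp add: v_def)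
  finally have "v = 0" by (rule nonsing)
  then show False using pv by simp
qed

end

lemma sum_bform_scale: 
  "(\<Sum>i\<in>I. bform M (x i) v *s x i) = (\<Sum>i\<in>I. outer (x i)) *v (M *v v)"
  by (simp add: sum_outer_mult_vec bform_scalar_product)

text \<open>Two zero diagonal entries are settled by \<open>removable_two_zeros\<close>. If there is
  just one, at p, and nothing is removable, then x p is orthogonal to the rest, and a switch through
  p creates two zero diagonal entries.\<close>

lemma removable_exists:
  fixes M :: "bit^'n^'n"
  assumes M: "transpose M = M" and fin: "finite I"
    and nonsing: "\<And>v. (\<Sum>i\<in>I. bform M (x i) v *s x i) = v \<Longrightarrow> v = 0"
    and red: "reducible (\<lambda>i j. bform M (x i) (x j)) I" and ne: "I \<noteq> {}"
  shows "\<exists>x' p. p \<in> I \<and> (\<Sum>i\<in>I. outer (x' i)) = (\<Sum>i\<in>I. outer (x i)) \<and>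
     bform M (x' p) (x' p) = 0 \<and> reducible (schur (bform M) (x' p) x') (I - {p})"
proof -
  let ?f = "bform M"
  have fam: "gram_family ?f x' I" if eq: "(\<Sum>i\<in>I. outer (x' i)) = (\<Sum>i\<in>I. outer (x i))" for x'
  proof
    show "v = 0" if "(\<Sum>i\<in>I. ?f (x' i) v *s x' i) = v" for v
      using nonsing[of v] that eq by (simp add: sum_bform_scale)
  qed (use fin bform_commute[OF M] in \<open>auto simp: bform_add_left bform_scale_left\<close>)
  interpret gram_family ?f x I by (rule fam) simp
  have removable
  proof (cases "\<forall>i\<in>I. \<forall>j\<in>I. ?f (x i) (x j) = 0")
    case True
    obtain p where "p \<in> I" using ne by blast
    then show ?thesis using True by (intro removableI[of p]) (auto simp: reducible_def)
  next
    case False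
    then obtain p i j where p: "p \<in> I" "?f (x p) (x p) = 0"
      and ij: "i \<in> I" "j \<in> I" "?f (x i) (x j) \<noteq> ?f (x i) (x i) * ?f (x j) (x j)"
      using red unfolding reducible_def by blast
    show ?thesis
    proof (cases "\<exists>q\<in>I - {p}. ?f (x q) (x q) = 0")
      case True
      then show ?thesis using removable_two_zeros[OF p _ _ _ ij] by blast
    next
      case False
      then have one: "?f (x i) (x i) = 1" if "i \<in> I - {p}" for i using that by auto
      show ?thesis
      proof (rule ccontr)
        assume nr: "\<not> removable"
        have p0: "?f (x p) (x i) = 0" if i: "i \<in> I - {p}" for i
          using not_removable_zero[OF nr p i ij] one[OF i] by simp
        have ip: "i \<noteq> p" "j \<noteq> p"
          using ij p p0[of i] p0[of j] sym[of "x i" "x p"] by (metis DiffI mult_zero_left mult_zero_right singletonD)+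
        then have fij: "?f (x i) (x j) = 0" "?f (x j) (x i) = 0" using ij one[of i] one[of j] sym[of "x i" "x j"] by auto
        have "i \<noteq> j" using fij one[of i] ij ip by auto
        \<comment> \<open>With only these three indices, x i would be orthogonal to the other two
          vectors and reproduced by the sum in \<open>nonsing\<close>.\<close>
        have "\<exists>k\<in>I. k \<notin> {p, i, j}"
        proof (rule ccontr)
          assume "\<not> ?thesis"
          then have I: "I = {p, i, j}" using ij p by auto
          have "(\<Sum>k\<in>I. ?f (x k) (x i) *s x k) = x i"
            using ip \<open>i \<noteq> j\<close> fij p0[of i] one[of i] by (simp add: I)
          then have "x i = 0" by (rule nonsing)
          then show False using one[of i] ij ip by simp
        qed
        then obtain k where k: "k \<in> I" "k \<notin> {p, i, j}" by blast
        have d: "distinct [p, i, j, k]" using k ip \<open>i \<noteq> j\<close> by auto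
        have sub: "{p, i, j, k} \<subseteq> I" using p ij k by auto
        define x' where "x' = switch4 x p i j k"
        note sw = switch4_simps[OF d, where x = x, folded x'_def]
        have sum: "(\<Sum>i\<in>I. outer (x' i)) = (\<Sum>i\<in>I. outer (x i))"
          unfolding x'_def by (rule sum_outer_switch4[OF fin sub d])
        interpret s: gram_family ?f x' I by (rule fam) fact
        have vals: "?f (x i) (x i) = 1" "?f (x j) (x j) = 1" "?f (x k) (x k) = 1"
           "?f (x p) (x i) = 0" "?f (x p) (x j) = 0" "?f (x p) (x k) = 0" "?f (x i) (x p) = 0"
           "?f (x j) (x p) = 0" "?f (x k) (x p) = 0" "?f (x p) (x p) = 0"
           "?f (x i) (x j) = 0" "?f (x j) (x i) = 0"
          using one[of i] one[of j] one[of k] p0[of i] p0[of j] p0[of k] p fij ip ij k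
            sym[of "x p" "x i"] sym[of "x p" "x j"] sym[of "x p" "x k"] by auto
        have jk: "?f (x k) (x i) = ?f (x i) (x k)" "?f (x k) (x j) = ?f (x j) (x k)" using sym by auto
        have z: "?f (x' i) (x' i) = 0" "?f (x' j) (x' j) = 0"
          by (simp_all add: sw add_left add_right vals jk)
        \<comment> \<open>With a = f(x i, x k) and b = f(x j, x k), the switched entries at (p, i),
          (p, j), (i, j) are a, b and a + b + 1. Rank at most one would make all three vanish, but
          their sum is 1.\<close>
        have "\<exists>a\<in>I. \<exists>b\<in>I. ?f (x' a) (x' b) \<noteq> ?f (x' a) (x' a) * ?f (x' b) (x' b)"
        proof (rule ccontr)
          assume "\<not> ?thesis"
          then have sq: "?f (x' a) (x' b) = ?f (x' a) (x' a) * ?f (x' b) (x' b)"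
            if "a \<in> I" "b \<in> I" for a b
            using that by blast
          have "?f (x' i) (x' j) = 0" "?f (x' p) (x' i) = 0" "?f (x' p) (x' j) = 0"
            using sq[of i j] sq[of p i] sq[of p j] ij p by (simp_all add: z)
          then show False
            by (cases "?f (x i) (x k)"; cases "?f (x j) (x k)")
              (simp_all add: sw add_left add_right vals jk)
        qed
        then have "s.removable" using s.removable_two_zeros[OF ij(1) z(1) ij(2) z(2) \<open>i \<noteq> j\<close>] by blast
        then show False using nr sum unfolding s.removable_def removable_def by simp
      qed
    qed
  qed
  then show ?thesis unfolding removable_def .
qed

subsection \<open>Walks and upper bounds\<close>

definition gamma_walk :: "nat \<Rightarrow> bit^'n^'n \<Rightarrow> bit^'n^'n \<Rightarrow> bool" where
  "gamma_walk k A B \<longleftrightarrow> (\<exists>p. p 0 = A \<and> p k = B \<and> (\<forall>i\<le>k. p i \<in> SGL) \<and>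
     (\<forall>i<k. gamma_adj (p i) (p (Suc i))))"

text \<open>An upper bound k \<le> m is enough, since the lower bound then forces k = m. This suits
  walks built from families that may contain zero vectors.\<close>

lemma gamma_dist_eqI:
  assumes "gamma_walk k A B" "k \<le> m" "\<And>k. gamma_walk k A B \<Longrightarrow> m \<le> k"
  shows "gamma_dist A B = enat m"
proof -
  have "k = m" using assms by fastforce
  then have "gamma_dist A B \<le> enat m"
    using assms(1) unfolding gamma_dist_def gamma_walk_def by (intro Inf_lower) auto
  moreover have "enat m \<le> gamma_dist A B"
    unfolding gamma_dist_def gamma_walk_def[symmetric]
    using assms(3) by (intro Inf_greatest) auto
  ultimately show ?thesis by (rule antisym)
qed

lemma gamma_walk_0: "A \<in> SGL \<Longrightarrow> gamma_walk 0 A A"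
  unfolding gamma_walk_def by auto

lemma gamma_walk_Suc:
  assumes "gamma_adj A C" "gamma_walk k C B"
  shows "gamma_walk (Suc k) A B"
proof -
  obtain p where p: "p 0 = C" "p k = B" "\<forall>i\<le>k. p i \<in> SGL" "\<forall>i<k. gamma_adj (p i) (p (Suc i))"
    using assms(2) unfolding gamma_walk_def by blast
  have "\<forall>i\<le>Suc k. case_nat A p i \<in> SGL"
    using p(3) assms(1) by (auto simp: gamma_adj_def split: nat.split)
  moreover have "\<forall>i<Suc k. gamma_adj (case_nat A p i) (case_nat A p (Suc i))"
    using p assms(1) by (auto split: nat.split)
  ultimately show ?thesis
    unfolding gamma_walk_def using p(2) by (intro exI[of _ "case_nat A p"]) auto
qed

lemma rank_outer: "p \<noteq> 0 \<Longrightarrow> rank (outer p) = 1"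
  using symmetric_rank_one_iff[OF transpose_outer, of p] by blast

lemma gamma_adj_add_outer:
  assumes "A \<in> SGL" "A + outer p \<in> SGL" "p \<noteq> 0"
  shows "gamma_adj A (A + outer p)"
proof -
  have "A - (A + outer p) = outer p" by (simp add: mat_bit_diff)
  then show ?thesis
    unfolding gamma_adj_def using assms rank_outer by metis
qed

lemma gamma_adjE:
  assumes "gamma_adj A B"
  obtains y where "B = A + outer y"
proof -
  have "transpose (A - B) = A - B"
    using assms by (auto simp: gamma_adj_def SGL_def vec_eq_iff transpose_def)
  then obtain y where "A - B = outer y"
    using assms symmetric_rank_one_iff unfolding gamma_adj_def by metis
  then have "B = A + outer y" by (metis mat_bit_diff mat_bit_add_left_self)
  then show thesis by (rule that)
qed

lemma gamma_walk_summands: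
  assumes "gamma_walk k A B"
  obtains y where "\<And>i. i \<le> k \<Longrightarrow> A + (\<Sum>j<i. outer (y j)) \<in> SGL"
    and "B = A + (\<Sum>j<k. outer (y j))"
proof -
  obtain p where p: "p 0 = A" "p k = B" "\<forall>i\<le>k. p i \<in> SGL" "\<forall>i<k. gamma_adj (p i) (p (Suc i))"
    using assms unfolding gamma_walk_def by blast
  have "\<forall>i. \<exists>y. i < k \<longrightarrow> p (Suc i) = p i + outer y" using p(4) gamma_adjE by metis
  then obtain y where y: "i < k \<Longrightarrow> p (Suc i) = p i + outer (y i)" for i by metis
  have "i \<le> k \<Longrightarrow> p i = A + (\<Sum>j<i. outer (y j))" for i
    by (induction i) (auto simp: p(1) y add.assoc)
  then show thesis using that[of y] p by auto
qed

text \<open>Induction on the size of the family: \<open>removable_exists\<close> supplies a step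
  that stays invertible, and the form of the new matrix gives the remaining family the reducible
  Gram matrix \<open>schur\<close>. A zero vector gives no edge and is skipped, hence the
  inequality.\<close>

lemma gamma_walk_le_card:
  assumes "finite I" "A \<in> SGL" "A + (\<Sum>i\<in>I. outer (x i)) \<in> SGL"
    and "reducible (\<lambda>i j. bform (matrix_inv A) (x i) (x j)) I"
  shows "\<exists>k\<le>card I. gamma_walk k A (A + (\<Sum>i\<in>I. outer (x i)))"
  using assms
proof (induction "card I" arbitrary: I A x)
  case 0
  then show ?case using gamma_walk_0 by auto
next
  case (Suc n)
  let ?M = "matrix_inv A"
  have "I \<noteq> {}" using Suc.hyps(2) by auto
  then obtain x' p where p: "p \<in> I" "(\<Sum>i\<in>I. outer (x' i)) = (\<Sum>i\<in>I. outer (x i))"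
      "bform ?M (x' p) (x' p) = 0" "reducible (schur (bform ?M) (x' p) x') (I - {p})"
    using removable_exists[OF transpose_matrix_inv[OF Suc.prems(2)] Suc.prems(1) _ Suc.prems(4)]
      SGL_sum_outer_kernel[OF Suc.prems(2,3)] by blast
  let ?A = "A + outer (x' p)"
  have B: "?A + (\<Sum>i\<in>I - {p}. outer (x' i)) = A + (\<Sum>i\<in>I. outer (x i))"
    using sum.remove[OF Suc.prems(1) p(1), of "\<lambda>i. outer (x' i)"] p(2) by (simp add: add.assoc)
  have A: "?A \<in> SGL" by (rule SGL_add_outer(1)[OF Suc.prems(2) p(3)])
  have n: "n = card (I - {p})" using Suc.hyps(2) p(1) Suc.prems(1) by simp
  have "\<exists>k\<le>card (I - {p}). gamma_walk k ?A (?A + (\<Sum>i\<in>I - {p}. outer (x' i)))"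
  proof (rule Suc.hyps(1)[OF n])
    show "reducible (\<lambda>i j. bform (matrix_inv ?A) (x' i) (x' j)) (I - {p})"
      using p(4) by (simp add: SGL_add_outer(2)[OF Suc.prems(2) p(3)])
  qed (use Suc.prems A in \<open>auto simp only: B finite_Diff\<close>)
  then obtain k where k: "k \<le> n" "gamma_walk k ?A (A + (\<Sum>i\<in>I. outer (x i)))"
    unfolding B n[symmetric] by blast
  show ?case
  proof (cases "x' p = 0")
    case True
    then show ?thesis using k Suc.hyps(2) by (intro exI[of _ k]) auto
  next
    case False
    then have "gamma_walk (Suc k) A (A + (\<Sum>i\<in>I. outer (x i)))"
      using gamma_walk_Suc[OF gamma_adj_add_outer[OF Suc.prems(2) A]] k(2) by blast
    then show ?thesis using k(1) Suc.hyps(2) by (intro exI[of _ "Suc k"]) auto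
  qed
qed

subsection \<open>Lower bounds\<close>

lemma scalar_product_sum_right:
  "scalar_product u (\<Sum>i\<in>I. v i) = (\<Sum>i\<in>I. scalar_product u (v i))" for u :: "bit^'n"
  by (induction I rule: infinite_finite_induct)
     (auto simp: scalar_product_def distrib_left sum.distrib)

lemma scalar_product_commute: "scalar_product u v = scalar_product v u" for u :: "bit^'n"
  by (simp add: scalar_product_def mult.commute)

lemma dual_vector_exists:
  fixes y :: "'j \<Rightarrow> bit^'n"
  assumes "inj_on y J" "vec.independent (y ` J)" "i \<in> J"
  shows "\<exists>z. \<forall>j\<in>J. scalar_product (y j) z = (if j = i then 1 else 0)"
proof -
  \<comment> \<open>Any coordinate serves: the functional is coordinate \<open>k\<close> of a linear
    map into \<open>bit^'n\<close>, represented by row \<open>k\<close> of its matrix.\<close>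
  obtain k :: 'n where True by simp
  obtain g where g: "Vector_Spaces.linear (*s) (*s) g"
    "\<forall>v\<in>y ` J. g v = (if v = y i then axis k 1 else (0::bit^'n))"
    using vec.linear_independent_extend[OF assms(2), of "\<lambda>v. if v = y i then axis k 1 else 0"] by blast
  have "scalar_product (y j) (row k (matrix g)) = g (y j) $ k" for j
    using matrix_works[OF g(1), of "y j"]
    by (metis (no_types, lifting) matrix_vector_mult_def mult.commute row_def scalar_product_def
        sum.cong vec_lambda_beta)
  moreover have "g (y j) $ k = (if j = i then 1 else 0)" if "j \<in> J" for j
    using g(2) that assms(1,3) by (auto simp: axis_def inj_on_eq_iff)
  ultimately show ?thesis by (intro exI[of _ "row k (matrix g)"]) simp
qed

text \<open>Applying both sums to the dual vector z of y_j gives y_j = sum c_i x_i with c_i = x_i^T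
  z. Pairing this with z and using c_i c_i = c_i gives sum c_i = z^T y_j = 1.\<close>

lemma independent_summand_in_span:
  fixes y :: "'j \<Rightarrow> bit^'n" and x :: "'i \<Rightarrow> bit^'n"
  assumes "inj_on y J" "vec.independent (y ` J)" "finite J" "j \<in> J"
    and eq: "(\<Sum>j\<in>J. outer (y j)) = (\<Sum>i\<in>I. outer (x i))"
  obtains c where "y j = (\<Sum>i\<in>I. c i *s x i)" "(\<Sum>i\<in>I. c i) = 1"
proof -
  obtain z where z: "\<forall>l\<in>J. scalar_product (y l) z = (if l = j then 1 else 0)"
    using dual_vector_exists[OF assms(1,2,4)] by blast
  have "(\<Sum>l\<in>J. scalar_product (y l) z *s y l) = (\<Sum>l\<in>J. if l = j then y l else 0)"
    using z by (intro sum.cong) auto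
  then have yj: "y j = (\<Sum>i\<in>I. scalar_product (x i) z *s x i)"
    using assms(3,4) sum_outer_mult_vec[of y J z] sum_outer_mult_vec[of x I z] eq by simp
  have "scalar_product z (y j) = (\<Sum>i\<in>I. scalar_product (x i) z)"
  proof -
    have "scalar_product z (scalar_product (x i) z *s x i) = scalar_product (x i) z" for i
    proof -
      have "scalar_product z (c *s x i) = c * scalar_product z (x i)" for c
        by (simp add: scalar_product_def sum_distrib_left mult.left_commute)
      then show ?thesis by (simp add: scalar_product_commute[of z])
    qed
    then show ?thesis by (subst yj) (simp add: scalar_product_sum_right)
  qed
  then have "(\<Sum>i\<in>I. scalar_product (x i) z) = 1"
    using z assms(4) by (simp add: scalar_product_commute)
  then show thesis by (rule that[OF yj])
qed

section \<open>The diagonal of a symmetric form, additive over the binary field\<close>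

lemma bform_diag_add:
  assumes "transpose M = M"
  shows "bform M (u + v) (u + v) = bform M u u + bform M v v"
  using bform_commute[OF assms, of u v] by (simp add: bform_add_left bform_add_right add.assoc)

lemma bform_diag_sum:
  assumes "transpose M = M"
  shows "bform M (\<Sum>i\<in>I. u i) (\<Sum>i\<in>I. u i) = (\<Sum>i\<in>I. bform M (u i) (u i))"
  by (induction I rule: infinite_finite_induct) (auto simp: bform_diag_add[OF assms])

text \<open>Since u \<mapsto> f(u, u) is linear, both sides are bilinear and agree on generators;
  \<open>half\<close> extends one argument at a time.\<close>

lemma bform_eq_diag_prod_span:
  assumes M: "transpose M = M"
    and sq: "\<And>u v. u \<in> S \<Longrightarrow> v \<in> S \<Longrightarrow> bform M u v = bform M u u * bform M v v"
    and "u \<in> vec.span S" "v \<in> vec.span S"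
  shows "bform M u v = bform M u u * bform M v v"
proof -
  have half: "bform M u v = bform M u u * bform M v v"
    if "u \<in> vec.span S" and base: "\<And>s. s \<in> S \<Longrightarrow> bform M s v = bform M s s * bform M v v" for u v
    using that(1)
  proof (induction rule: vec.span_induct)
    case base
    have "bform M (c *s u) v = bform M (c *s u) (c *s u) * bform M v v"
      if "bform M u v = bform M u u * bform M v v" for c u
      using that by (cases c) auto
    then show ?case
      by (auto simp: vec.subspace_def bform_diag_add[OF M] bform_add_left[of M _ _ v] distrib_right)
  qed (rule base)
  show ?thesis
  proof (rule half[OF assms(3)])
    fix s assume s: "s \<in> S"
    have "bform M v s = bform M v v * bform M s s"
      by (rule half[OF assms(4)]) (rule sq[OF _ s])
    then show "bform M s v = bform M s s * bform M v v"
      by (simp only: bform_commute[OF M, of s v] mult.commute)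
  qed
qed

section \<open>Walks with summands \<open>y\<close>, compared with the independent family
  \<open>x\<close>\<close>

context
  fixes A :: "bit^'n^'n" and x :: "'r::finite \<Rightarrow> bit^'n" and y :: "nat \<Rightarrow> bit^'n" and k :: nat
  assumes A: "A \<in> SGL"
    and steps: "\<And>i. i \<le> k \<Longrightarrow> A + (\<Sum>j<i. outer (y j)) \<in> SGL"
    and x: "inj x" "vec.independent (range x)"
    and eq: "(\<Sum>j<k. outer (y j)) = (\<Sum>i\<in>UNIV. outer (x i))"
begin

lemma range_subset_span: "range x \<subseteq> vec.span (y ` {..<k})"
proof safe
  fix i
  obtain c where "x i = (\<Sum>j<k. c j *s y j)"
    using independent_summand_in_span[OF x finite _ eq[symmetric], of i] by auto
  then show "x i \<in> vec.span (y ` {..<k})"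
    by (simp only:) (intro vec.span_sum vec.span_scale vec.span_base imageI)
qed

lemma card_le_walk_length: "CARD('r) \<le> k"
proof -
  have "card (range x) \<le> card (y ` {..<k})"
    using vec.independent_span_bound[OF _ x(2) range_subset_span] by simp
  then show ?thesis
    using card_image_le[of "{..<k}" y] by (simp add: card_image[OF x(1)])
qed

lemma summands_independent:
  assumes "k \<le> vec.dim (y ` {..<k})"
  shows "inj_on y {..<k}" "vec.independent (y ` {..<k})"
proof -
  have "vec.dim (y ` {..<k}) \<le> card (y ` {..<k})" by (rule vec.dim_le_card') simp
  moreover have "card (y ` {..<k}) \<le> k" using card_image_le[of "{..<k}" y] by simp
  ultimately have c: "card (y ` {..<k}) = k" using assms by simp
  then show "inj_on y {..<k}" by (intro eq_card_imp_inj_on) auto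
  show "vec.independent (y ` {..<k})"
    by (rule vec.card_le_dim_spanning[of _ "y ` {..<k}"]) (use c assms in \<open>auto intro: vec.span_base\<close>)
qed

lemma walk_length_alternating:
  assumes "\<And>i. bform (matrix_inv A) (x i) (x i) = 1"
  shows "CARD('r) + 1 \<le> k"
proof (rule ccontr)
  assume "\<not> ?thesis"
  then have k: "k = CARD('r)" using card_le_walk_length by simp
  have "card (range x) \<le> vec.dim (vec.span (y ` {..<k}))"
    by (rule vec.independent_card_le_dim[OF range_subset_span x(2)])
  then have "k \<le> vec.dim (y ` {..<k})" by (simp add: card_image[OF x(1)] k)
  note ind = summands_independent[OF this]
  have "0 < k" by (simp add: k)
  then obtain c where c: "y 0 = (\<Sum>i\<in>UNIV. c i *s x i)" "(\<Sum>i\<in>UNIV. c i) = 1"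
    using independent_summand_in_span[OF ind _ _ eq, of 0] by auto
  \<comment> \<open>By additivity of the diagonal this value is the sum of the coefficients c_i,
    which is 1.\<close>
  have "bform (matrix_inv A) (y 0) (y 0) = 1"
    using c by (simp add: bform_diag_sum[OF transpose_matrix_inv[OF A]] bform_scale_left
        bform_scale_right assms)
  moreover have "A + (\<Sum>j<Suc 0. outer (y j)) \<in> SGL" using steps[of "Suc 0"] \<open>0 < k\<close> by simp
  then have "(\<Sum>j<Suc 0. bform (matrix_inv A) (y j) v *s y j) = v \<Longrightarrow> v = 0" for v
    by (rule SGL_sum_outer_kernel[OF A])
  ultimately have "y 0 = 0" by simp
  then show False using \<open>bform (matrix_inv A) (y 0) (y 0) = 1\<close> by simp
qed

lemma walk_length_rank_one:
  assumes sq: "\<And>i j. bform (matrix_inv A) (x i) (x j) =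
      bform (matrix_inv A) (x i) (x i) * bform (matrix_inv A) (x j) (x j)"
    and t: "bform (matrix_inv A) (x t) (x t) = 1"
  shows "CARD('r) + 2 \<le> k"
proof (rule ccontr)
  let ?f = "bform (matrix_inv A)"
  note M = transpose_matrix_inv[OF A]
  assume "\<not> ?thesis"
  then have k: "k \<le> CARD('r) + 1" by simp
  \<comment> \<open>If the y_j are independent, duality applies. Otherwise their span has dimension
    at most r and contains the r independent x_i, so the two spans agree.\<close>
  have ysub: "y j \<in> vec.span (range x)" if j: "j < k" for j
  proof (cases "k \<le> vec.dim (y ` {..<k})")
    case True
    note ind = summands_independent[OF this]
    obtain c where "y j = (\<Sum>i\<in>UNIV. c i *s x i)"
      using independent_summand_in_span[OF ind _ _ eq, of j] j by auto
    then show ?thesis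
      by (simp add: vec.span_sum vec.span_scale vec.span_base)
  next
    case False
    then have "vec.dim (vec.span (y ` {..<k})) \<le> card (range x)"
      using k by (simp add: card_image[OF x(1)])
    then have "vec.span (y ` {..<k}) \<subseteq> vec.span (range x)"
      by (rule vec.card_ge_dim_independent[OF range_subset_span x(2)])
    then show ?thesis using j vec.span_base[of "y j" "y ` {..<k}"] by auto
  qed
  have fsq: "?f u v = ?f u u * ?f v v" if "u \<in> vec.span (range x)" "v \<in> vec.span (range x)" for u v
    using bform_eq_diag_prod_span[OF M _ that] sq by blast
  have y0: "i < k \<Longrightarrow> ?f (y i) (y i) = 0" for i
  proof (induction i rule: less_induct)
    case (less i)
    show ?case
    proof (rule ccontr)
      assume "?f (y i) (y i) \<noteq> 0"
      then have one: "?f (y i) (y i) = 1" by simp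
      \<comment> \<open>The earlier summands are isotropic, hence orthogonal to y_i by
        \<open>fsq\<close>; the kernel criterion after step i then forces y_i = 0.\<close>
      have "?f (y j) (y i) = 0" if "j < i" for j
        using fsq[OF ysub ysub, of j i] less that by simp
      then have "(\<Sum>j<Suc i. ?f (y j) (y i) *s y j) = y i"
        using one by simp
      moreover have "A + (\<Sum>j<Suc i. outer (y j)) \<in> SGL" using steps[of "Suc i"] less.prems by simp
      ultimately have "y i = 0" using SGL_sum_outer_kernel[OF A] by blast
      then show False using one by simp
    qed
  qed
  have "?f u u = 0" if "u \<in> vec.span (y ` {..<k})" for u
    using that
  proof (induction rule: vec.span_induct)
    case base
    show ?case
      by (auto simp: vec.subspace_def bform_diag_add[OF M] bform_scale_left bform_scale_right)
  qed (use y0 in auto)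
  then show False using range_subset_span t by (metis rangeI subsetD zero_neq_one)
qed

end

subsection \<open>The exceptional cases\<close>

text \<open>Otherwise u and w are orthogonal to all isotropic vectors. A vector y is isotropic, or
  else y + u and y + w are; either way f(y, u) = f(y, w). Nondegeneracy then gives u = w.\<close>

lemma isotropic_vector_exists:
  assumes A: "A \<in> SGL" and "u \<noteq> w"
    and u: "bform (matrix_inv A) u u = 1" and w: "bform (matrix_inv A) w w = 1"
  obtains y where "bform (matrix_inv A) y y = 0"
    "bform (matrix_inv A) y u = 1 \<or> bform (matrix_inv A) y w = 1"
proof (rule ccontr)
  let ?f = "bform (matrix_inv A)"
  assume "\<not> thesis"
  then have no: "?f y y = 0 \<Longrightarrow> ?f y u = 0 \<and> ?f y w = 0" for y
    using that by (metis bit_not_one_iff)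
  have "?f y (u + w) = 0" for y
  proof (cases "?f y y = 0")
    case True
    then show ?thesis using no by (simp add: bform_add_right)
  next
    case False
    then have "?f (y + u) (y + u) = 0" "?f (y + w) (y + w) = 0"
      using u w by (simp_all add: bform_diag_add[OF transpose_matrix_inv[OF A]])
    then have "?f (y + u) u = 0" "?f (y + w) w = 0" using no by auto
    then have "?f y u + 1 = 0" "?f y w + 1 = 0" using u w by (simp_all add: bform_add_left)
    then show ?thesis by (cases "?f y u"; cases "?f y w") (auto simp: bform_add_right)
  qed
  then have "(\<Sum>k\<in>UNIV. axis i 1 $ k * (matrix_inv A *v (u + w)) $ k) = 0" for i
    unfolding bform_def by blast
  then have "(matrix_inv A *v (u + w)) $ i = 0" for i
    by (simp add: axis_def if_distrib[of "\<lambda>c. c * _"] cong: if_cong)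
  then have "matrix_inv A *v (u + w) = 0" by (simp add: vec_eq_iff)
  then have "u + w = 0" using SGL_inv_apply(1)[OF A, of "u + w"] by simp
  then show False using \<open>u \<noteq> w\<close> by (simp add: vec_bit_add_eq_0_iff)
qed

text \<open>Trace zero follows from invertibility of the end matrix: v = sum f(x_j, x_j) x_j pairs
  with x_i to f(x_i, x_i) times the trace, so trace 1 would make v a nonzero vector reproduced by
  the sum.\<close>

lemma gram_mem_R1Tr0_iff:
  fixes x :: "'r::finite \<Rightarrow> bit^'n"
  assumes A: "A \<in> SGL" and B: "A + (\<Sum>i\<in>UNIV. outer (x i)) \<in> SGL"
  defines "f \<equiv> \<lambda>i j. bform (matrix_inv A) (x i) (x j)"
  shows "(\<chi> i j. f i j) \<in> R1Tr0 \<longleftrightarrow> (\<forall>i j. f i j = f i i * f j j) \<and> (\<exists>i. f i i = 1)"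
proof
  assume "(\<chi> i j. f i j) \<in> R1Tr0"
  then obtain y where y: "y \<noteq> 0" "(\<chi> i j. f i j) = outer y"
    unfolding R1Tr0_def using symmetric_rank_one_iff by blast
  then have "f i j = y $ i * y $ j" for i j by (simp add: vec_eq_iff outer_def)
  then show "(\<forall>i j. f i j = f i i * f j j) \<and> (\<exists>i. f i i = 1)"
    using y(1) by (auto simp: vec_eq_iff)
next
  assume "(\<forall>i j. f i j = f i i * f j j) \<and> (\<exists>i. f i i = 1)"
  then obtain t where sq: "\<And>i j. f i j = f i i * f j j" and t: "f t t = 1" by blast
  have G: "(\<chi> i j. f i j) = outer (\<chi> i. f i i)"
    by (simp add: vec_eq_iff outer_def) (intro allI sq)
  have "rank (\<chi> i j. f i j) = 1"
    unfolding G using t by (intro rank_outer) (auto simp: vec_eq_iff)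
  moreover have "(\<Sum>i\<in>UNIV. f i i) = 0"
  proof (rule ccontr)
    assume "(\<Sum>i\<in>UNIV. f i i) \<noteq> 0"
    then have tr: "(\<Sum>i\<in>UNIV. f i i) = 1" by simp
    define v where "v = (\<Sum>j\<in>UNIV. f j j *s x j)"
    have fv: "bform (matrix_inv A) (x i) v = f i i" for i
    proof -
      have "bform (matrix_inv A) (x i) v = (\<Sum>j\<in>UNIV. f j j * f i j)"
        by (simp add: v_def bform_sum_right bform_scale_right f_def)
      also have "\<dots> = (\<Sum>j\<in>UNIV. f i i * f j j)"
      proof (intro sum.cong refl)
        show "f j j * f i j = f i i * f j j" for j
          using sq[of i j] by (simp add: mult.left_commute)
      qed
      finally show ?thesis by (simp add: tr flip: sum_distrib_left)
    qed
    have "v = 0"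
      by (rule SGL_sum_outer_kernel[OF A B]) (simp only: fv, simp only: v_def)
    then show False using fv[of t] t by simp
  qed
  ultimately show "(\<chi> i j. f i j) \<in> R1Tr0"
    using transpose_outer[of "\<chi> i. f i i", folded G] unfolding R1Tr0_def trace_def by simp
qed

section \<open>The distance formula, by matching upper and lower bounds\<close>

theorem theorem2p1:
  fixes A B :: "bit^'n^'n" and x :: "'r::finite \<Rightarrow> bit^'n"
  assumes "A \<in> SGL" and "B \<in> SGL"
    and "inj x" and "vec.independent (range x)"
    and "B - A = (\<Sum>i\<in>UNIV. outer (x i))"
  shows "((\<forall>i. bform (matrix_inv A) (x i) (x i) = 1) \<longrightarrow>
           gamma_dist A B = (if \<forall>i j. bform (matrix_inv A) (x i) (x j) = 1
                             then enat (CARD('r) + 2) else enat (CARD('r) + 1)))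
       \<and> ((\<chi> i j. bform (matrix_inv A) (x i) (x j)) \<in> R1Tr0 \<longrightarrow>
           gamma_dist A B = enat (CARD('r) + 2))
       \<and> (\<not> (\<forall>i. bform (matrix_inv A) (x i) (x i) = 1)
           \<and> (\<chi> i j. bform (matrix_inv A) (x i) (x j)) \<notin> R1Tr0 \<longrightarrow>
           gamma_dist A B = enat (CARD('r)))"
proof -
  define f where "f i j = bform (matrix_inv A) (x i) (x j)" for i j
  let ?sq = "\<forall>i j. f i j = f i i * f j j"
  have B: "B = A + (\<Sum>i\<in>UNIV. outer (x i))"
    using assms(5) by (metis mat_bit_diff mat_bit_add_left_self add.commute)
  have BS: "A + (\<Sum>i\<in>UNIV. outer (x i)) \<in> SGL" using assms(2) B by simp
  have R1: "(\<chi> i j. bform (matrix_inv A) (x i) (x j)) \<in> R1Tr0 \<longleftrightarrow> ?sq \<and> (\<exists>i. f i i = 1)"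
    using gram_mem_R1Tr0_iff[OF assms(1) BS] unfolding f_def .
  have summands: "\<exists>y. (\<forall>i\<le>k. A + (\<Sum>j<i. outer (y j)) \<in> SGL) \<and>
      (\<Sum>j<k. outer (y j)) = (\<Sum>i\<in>UNIV. outer (x i))" if "gamma_walk k A B" for k
    using gamma_walk_summands[OF that] unfolding B by (metis add_left_cancel)
  have rank_one: "gamma_dist A B = enat (CARD('r) + 2)" if sq: ?sq and t: "f t t = 1" for t
  proof -
    \<comment> \<open>If t were the only such index, x t would be orthogonal to the other x i and so
      violate invertibility of the end matrix.\<close>
    have "\<exists>t'. t' \<noteq> t \<and> f t' t' = 1"
    proof (rule ccontr)
      assume "\<not> ?thesis"
      then have z: "f i i = 0" if "i \<noteq> t" for i using that by auto
      have "f i t = (if i = t then 1 else 0)" for i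
        using sq[rule_format, of i t] t z[of i] by auto
      then have "(\<Sum>i\<in>UNIV. bform (matrix_inv A) (x i) (x t) *s x i)
          = (\<Sum>i\<in>UNIV. if i = t then x i else 0)"
        by (intro sum.cong) (auto simp: f_def)
      then have "x t = 0" by (intro SGL_sum_outer_kernel[OF assms(1) BS]) simp
      then show False using t by (simp add: f_def)
    qed
    then obtain t' where t': "t' \<noteq> t" "f t' t' = 1" by blast
    then have "x t \<noteq> x t'" using assms(3) by (auto dest: injD)
    then obtain y u where y: "bform (matrix_inv A) y y = 0" "bform (matrix_inv A) y (x u) = 1"
      using isotropic_vector_exists[OF assms(1), of "x t" "x t'"] t t' unfolding f_def by metis
    \<comment> \<open>\<open>bool\<close> indexes two copies of \<open>y\<close>, whose outer
      products cancel. They add a zero diagonal entry, and pairing with \<open>x u\<close> breaks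
      rank one.\<close>
    define x' where "x' = case_sum x (\<lambda>_::bool. y)"
    have sum: "(\<Sum>i\<in>UNIV. outer (x' i)) = (\<Sum>i\<in>UNIV. outer (x i))"
      unfolding UNIV_Plus_UNIV[symmetric]
      by (subst sum.Plus) (auto simp: x'_def UNIV_bool)
    have "reducible (\<lambda>i j. bform (matrix_inv A) (x' i) (x' j)) UNIV"
      using y by (intro reducibleI[of "Inr True" _ _ "Inr True" "Inl u"]) (auto simp: x'_def)
    then have "\<exists>k\<le>CARD('r + bool). gamma_walk k A B"
      using gamma_walk_le_card[OF finite assms(1), where I = UNIV and x = x'] BS unfolding sum B by blast
    then obtain k where "k \<le> CARD('r) + 2" "gamma_walk k A B"
      by (auto simp: card_UNIV_sum)
    then show ?thesis
    proof (intro gamma_dist_eqI)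
      fix k assume "gamma_walk k A B"
      then show "CARD('r) + 2 \<le> k"
        using summands walk_length_rank_one[OF assms(1) _ assms(3,4)] sq t unfolding f_def by metis
    qed
  qed
  have alternating: "gamma_dist A B = enat (CARD('r) + 1)" if nsq: "\<not> ?sq" and d: "\<And>i. f i i = 1"
  proof -
    obtain i0 j0 where ij: "f i0 j0 \<noteq> f i0 i0 * f j0 j0" using nsq by blast
    \<comment> \<open>The added zero vector supplies the missing zero diagonal entry;
      \<open>i0\<close> and \<open>j0\<close> already exclude rank one.\<close>
    define x' where "x' = case_sum x (\<lambda>_::unit. 0)"
    have sum: "(\<Sum>i\<in>UNIV. outer (x' i)) = (\<Sum>i\<in>UNIV. outer (x i))"
      unfolding UNIV_Plus_UNIV[symmetric]
      by (subst sum.Plus) (auto simp: x'_def UNIV_unit)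
    have "reducible (\<lambda>i j. bform (matrix_inv A) (x' i) (x' j)) UNIV"
      using ij by (intro reducibleI[of "Inr ()" _ _ "Inl i0" "Inl j0"]) (auto simp: x'_def f_def)
    then have "\<exists>k\<le>CARD('r + unit). gamma_walk k A B"
      using gamma_walk_le_card[OF finite assms(1), where I = UNIV and x = x'] BS unfolding sum B by blast
    then obtain k where "k \<le> CARD('r) + 1" "gamma_walk k A B"
      by (auto simp: card_UNIV_sum)
    then show ?thesis
    proof (intro gamma_dist_eqI)
      fix k assume "gamma_walk k A B"
      then show "CARD('r) + 1 \<le> k"
        using summands walk_length_alternating[OF assms(1) _ assms(3,4)] d unfolding f_def by metis
    qed
  qed
  have generic: "gamma_dist A B = enat (CARD('r))"
    if "\<not> (\<forall>i. f i i = 1)" "\<not> (?sq \<and> (\<exists>i. f i i = 1))"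
  proof -
    have "reducible f UNIV"
    proof (cases ?sq)
      case True
      then have "\<not> (\<exists>i. f i i = 1)" using that(2) by blast
      then have z: "f i i = 0" for i by auto
      have "f i j = 0" for i j using True[rule_format, of i j] z by simp
      then show ?thesis by (simp add: reducible_def)
    next
      case False
      then show ?thesis using that(1) by (auto simp: reducible_def)
    qed
    then have "\<exists>k\<le>CARD('r). gamma_walk k A B"
      using gamma_walk_le_card[OF finite assms(1) BS] unfolding f_def B by blast
    then obtain k where "k \<le> CARD('r)" "gamma_walk k A B" by blast
    then show ?thesis
    proof (intro gamma_dist_eqI)
      fix k assume "gamma_walk k A B"
      then show "CARD('r) \<le> k"
        using summands card_le_walk_length[OF assms(1) _ assms(3,4)] by metis
    qed
  qed
  have "gamma_dist A B = (if \<forall>i j. f i j = 1 then enat (CARD('r) + 2) else enat (CARD('r) + 1))"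
    if d: "\<forall>i. f i i = 1"
  proof -
    \<comment> \<open>With diagonal 1, the rank-one condition says that all entries are 1, so the
      two cases of (i) are \<open>rank_one\<close> and \<open>alternating\<close>.\<close>
    have "?sq \<longleftrightarrow> (\<forall>i j. f i j = 1)" using d by simp
    then show ?thesis using rank_one alternating d by auto
  qed
  then show ?thesis
    using rank_one generic R1 unfolding f_def by blast
qed

end
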